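(* Let $X$ be a complex Banach space, let $A:\operatorname{dom}(A)\subseteq X\to X$ and $B:\operatorname{dom}(B)\subseteq X\to X$ be closed linear operators with $\rho(B)\neq\emptyset$, and let $Y$ be a Banach space continuously embedded in $X$ such that $\operatorname{dom}(A)\subseteq\operatorname{dom}(B^2)\cap Y$, $B(\operatorname{dom}(A))\subseteq Y\subseteq\operatorname{dom}(B)$, and the operator $G=\begin{bmatrix}-B & I \\ A+B^2 & -B\end{bmatrix}$ with domain $\operatorname{dom}(A)\times Y$ generates a $C_0$-group $\{\mathcal T(t)\}_{t\in\mathbb R}$ on $Y\times X$. Write $C=C_{A,B}$, $S=S_{A,B}$. Then for all $t,s\in\mathbb R$: (i) $C(t+s)x-C(t-s)x=2S(s)C'(t)x+4\int_0^sS(s-\xi)BC'(t-\xi)x\,d\xi$ for $x\in\operatorname{dom}(A)$; (ii) $C(t+s)y-C(t-s)y=2S(s)C'(t)y-4\int_0^sS'(s-\xi)BC(t-\xi)y\,d\xi+4S(s)BC(t)y$ for $y\in Y$; (iii) $C(t+s)x+C(t-s)x=2C(s)C(t)x-4\int_0^sS(s-\xi)BC'(t-\xi)x\,d\xi$ for $x\in\operatorname{dom}(A)$; (iv) $C(t+s)y+C(t-s)y=2C(s)C(t)y+4\int_0^sS'(s-\xi)BC(t-\xi)y\,d\xi-4S(s)BC(t)y$ for $y\in Y$; (v) $S(t+s)y-S(t-s)y=2S(s)S'(t)y+4\int_0^sS(s-\xi)BS'(t-\xi)y\,d\xi$ for $y\in Y$; (vi) $S(t+s)x-S(t-s)x=2S(s)S'(t)x-4\int_0^sS'(s-\xi)BS(t-\xi)x\,d\xi+4S(s)BS(t)x$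 for $x\in X$; (vii) $S(t+s)y+S(t-s)y=2C(s)S(t)y-4\int_0^sS(s-\xi)BS'(t-\xi)y\,d\xi$ for $y\in Y$; (viii) $S(t+s)x+S(t-s)x=2C(s)S(t)x+4\int_0^sS'(s-\xi)BS(t-\xi)x\,d\xi-4S(s)BS(t)x$ for $x\in X$.
   Context: Write $\mathcal T(t)=\begin{bmatrix}T_{11}(t) & T_{12}(t) \\ T_{21}(t) & T_{22}(t)\end{bmatrix}$ in block form with respect to $Y\times X$. The generalized cosine and sine families $C_{A,B}(t)\in\mathcal B(\operatorname{dom}(B),X)$ (graph norm on $\operatorname{dom}(B)$) and $S_{A,B}(t)\in\mathcal B(X)$ are given by $C_{A,B}(t)x=T_{22}(t)x-BT_{12}(t)x+2T_{12}(t)Bx$ for $x\in\operatorname{dom}(B)$ and $S_{A,B}(t)x=T_{12}(t)x$ for $x\in X$. It is known that $S_{A,B}(t)X\subseteq Y$, $C_{A,B}(t)Y\subseteq Y$, $S_{A,B}'(t)Y\subseteq Y$, $C_{A,B}'(t)\operatorname{dom}(A)\subseteq Y$, $S_{A,B}(\cdot)x\in\mathcal C^1(\mathbb R,X)$ for $x\in X$ and $C_{A,B}(\cdot)y\in\mathcal C^1(\mathbb R,X)$ for $y\in Y$; $S_{A,B}'(t)x:=(S_{A,B}(t)x)'$ and $C_{A,B}'(t)y:=(C_{A,B}(t)y)'$ denote the (strong) derivatives in $X$. *)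

theory Defs
  imports "HOL-Analysis.Analysis"
begin

section \<open>Complex Banach spaces\<close>

class scaleC =
  fixes scaleC :: "complex \<Rightarrow> 'a \<Rightarrow> 'a" (infixr "*\<^sub>C" 75)

class complex_normed_vector = real_normed_vector + scaleC +
  assumes scaleC_add_right: "c *\<^sub>C (x + y) = c *\<^sub>C x + c *\<^sub>C y"
    and scaleC_add_left: "(c + d) *\<^sub>C x = c *\<^sub>C x + d *\<^sub>C x"
    and scaleC_scaleC: "c *\<^sub>C (d *\<^sub>C x) = (c * d) *\<^sub>C x"
    and scaleC_of_real: "complex_of_real r *\<^sub>C x = r *\<^sub>R x"
    and norm_scaleC: "norm (c *\<^sub>C x) = cmod c * norm x"

class complex_banach = complex_normed_vector + banach

instantiation prod :: (complex_normed_vector, complex_normed_vector) complex_normed_vector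
begin

definition scaleC_prod :: "complex \<Rightarrow> 'a \<times> 'b \<Rightarrow> 'a \<times> 'b" where
  "scaleC_prod c p = (c *\<^sub>C fst p, c *\<^sub>C snd p)"

instance
proof
  fix c d :: complex and r :: real and x y :: "'a \<times> 'b"
  show "c *\<^sub>C (x + y) = c *\<^sub>C x + c *\<^sub>C y"
    by (simp add: scaleC_prod_def scaleC_add_right)
  show "(c + d) *\<^sub>C x = c *\<^sub>C x + d *\<^sub>C x"
    by (simp add: scaleC_prod_def scaleC_add_left)
  show "c *\<^sub>C (d *\<^sub>C x) = (c * d) *\<^sub>C x"
    by (simp add: scaleC_prod_def scaleC_scaleC)
  show "complex_of_real r *\<^sub>C x = r *\<^sub>R x"
    by (simp add: scaleC_prod_def scaleC_of_real prod_eq_iff)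
  have "(cmod c * norm (fst x))\<^sup>2 + (cmod c * norm (snd x))\<^sup>2
      = (cmod c)\<^sup>2 * ((norm (fst x))\<^sup>2 + (norm (snd x))\<^sup>2)"
    by (simp add: power_mult_distrib distrib_left)
  then show "norm (c *\<^sub>C x) = cmod c * norm x"
    by (simp add: scaleC_prod_def norm_prod_def norm_scaleC real_sqrt_mult)
qed

end

instance prod :: (complex_banach, complex_banach) complex_banach ..

definition bounded_clinear ::
    "('a::complex_normed_vector \<Rightarrow> 'b::complex_normed_vector) \<Rightarrow> bool" where
  "bounded_clinear f \<longleftrightarrow> bounded_linear f \<and> (\<forall>c x. f (c *\<^sub>C x) = c *\<^sub>C f x)"


section \<open>Unbounded operators and groups\<close>

text \<open>An operator with domain \<open>D\<close> is a pair \<open>D\<close>, \<open>A\<close>; the values of the total function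
  \<open>A\<close> outside \<open>D\<close> are irrelevant.\<close>

definition closed_operator ::
    "'a::complex_normed_vector set \<Rightarrow> ('a \<Rightarrow> 'a) \<Rightarrow> bool" where
  "closed_operator D A \<longleftrightarrow>
     0 \<in> D \<and>
     (\<forall>x\<in>D. \<forall>y\<in>D. x + y \<in> D \<and> A (x + y) = A x + A y) \<and>
     (\<forall>c. \<forall>x\<in>D. c *\<^sub>C x \<in> D \<and> A (c *\<^sub>C x) = c *\<^sub>C A x) \<and>
     closed ((\<lambda>x. (x, A x)) ` D)"

definition resolvent_set ::
    "'a::complex_normed_vector set \<Rightarrow> ('a \<Rightarrow> 'a) \<Rightarrow> complex set" where
  "resolvent_set D A =
     {c. bij_betw (\<lambda>x. c *\<^sub>C x - A x) D UNIV \<and>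
         bounded_clinear (inv_into D (\<lambda>x. c *\<^sub>C x - A x))}"

definition C0_group :: "(real \<Rightarrow> 'a \<Rightarrow> 'a::complex_normed_vector) \<Rightarrow> bool" where
  "C0_group T \<longleftrightarrow>
     (\<forall>t. bounded_clinear (T t)) \<and>
     (\<forall>x. T 0 x = x) \<and>
     (\<forall>t s x. T (t + s) x = T t (T s x)) \<and>
     (\<forall>x. continuous_on UNIV (\<lambda>t. T t x))"

definition generates_C0_group ::
    "'a::complex_normed_vector set \<Rightarrow> ('a \<Rightarrow> 'a) \<Rightarrow> (real \<Rightarrow> 'a \<Rightarrow> 'a) \<Rightarrow> bool" where
  "generates_C0_group D G T \<longleftrightarrow>
     C0_group T \<and>
     D = {x. \<exists>y. ((\<lambda>h. (T h x - x) /\<^sub>R h) \<longlongrightarrow> y) (at 0)} \<and>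
     (\<forall>x\<in>D. ((\<lambda>h. (T h x - x) /\<^sub>R h) \<longlongrightarrow> G x) (at 0))"


section \<open>The operator matrix and the generalized cosine and sine families\<close>

text \<open>The space \<open>Y\<close> is a type of its own, with an injective bounded linear map
  \<open>j :: 'y \<Rightarrow> 'x\<close> as the continuous embedding. As a subset of \<open>X\<close>, \<open>Y\<close> is \<open>range j\<close>.\<close>

definition continuous_embedding ::
    "('y::complex_normed_vector \<Rightarrow> 'x::complex_normed_vector) \<Rightarrow> bool" where
  "continuous_embedding j \<longleftrightarrow> bounded_clinear j \<and> inj j"

definition G_dom :: "('y \<Rightarrow> 'x) \<Rightarrow> 'x set \<Rightarrow> ('y \<times> 'x) set" where
  "G_dom j DA = {(y, x). j y \<in> DA \<and> x \<in> range j}"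

text \<open>The first component \<open>-By + x\<close> is an element of \<open>range j\<close> on the domain of the matrix,
  and \<open>inv j\<close> reads it as an element of \<open>Y\<close>.\<close>

definition G_op ::
    "('y \<Rightarrow> 'x) \<Rightarrow> ('x \<Rightarrow> 'x) \<Rightarrow> ('x \<Rightarrow> 'x) \<Rightarrow> 'y \<times> 'x \<Rightarrow> 'y \<times> 'x::real_vector" where
  "G_op j A B = (\<lambda>(y, x). (inv j (- B (j y) + x), A (j y) + B (B (j y)) - B x))"

definition T12 :: "(real \<Rightarrow> 'y::zero \<times> 'x \<Rightarrow> 'y \<times> 'x) \<Rightarrow> real \<Rightarrow> 'x \<Rightarrow> 'y" where
  "T12 T t x = fst (T t (0, x))"

definition T22 :: "(real \<Rightarrow> 'y::zero \<times> 'x \<Rightarrow> 'y \<times> 'x) \<Rightarrow> real \<Rightarrow> 'x \<Rightarrow> 'x" where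
  "T22 T t x = snd (T t (0, x))"

text \<open>The value of \<open>gen_cosine\<close> is meaningful for \<open>x\<close> in the domain of \<open>B\<close> only.\<close>

definition gen_cosine ::
    "('y::zero \<Rightarrow> 'x) \<Rightarrow> ('x \<Rightarrow> 'x) \<Rightarrow> (real \<Rightarrow> 'y \<times> 'x \<Rightarrow> 'y \<times> 'x) \<Rightarrow> real \<Rightarrow> 'x \<Rightarrow> 'x::real_vector"
  where
  "gen_cosine j B T t x = T22 T t x - B (j (T12 T t x)) + 2 *\<^sub>R j (T12 T t (B x))"

definition gen_sine ::
    "('y::zero \<Rightarrow> 'x) \<Rightarrow> (real \<Rightarrow> 'y \<times> 'x \<Rightarrow> 'y \<times> 'x) \<Rightarrow> real \<Rightarrow> 'x \<Rightarrow> 'x" where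
  "gen_sine j T t x = j (T12 T t x)"

definition strong_deriv :: "(real \<Rightarrow> 'a \<Rightarrow> 'b::real_normed_vector) \<Rightarrow> real \<Rightarrow> 'a \<Rightarrow> 'b" where
  "strong_deriv F t x = vector_derivative (\<lambda>r. F r x) (at t)"

text \<open>The integral from \<open>a\<close> to \<open>b\<close>, with the usual sign convention for \<open>b < a\<close>.\<close>

definition oriented_integral ::
    "real \<Rightarrow> real \<Rightarrow> (real \<Rightarrow> 'a::real_normed_vector) \<Rightarrow> 'a" where
  "oriented_integral a b f = (if a \<le> b then integral {a..b} f else - integral {b..a} f)"

end

theory Submission
  imports Defs
begin

text \<open>Write an orbit of the group as \<open>T(t)z = (u(t), v(t))\<close>. Then \<open>u' = v - Bu\<close> in \<open>X\<close>, the
  sine family is \<open>u\<close> for the initial value \<open>(0, x)\<close>, and the cosine family on \<open>Y\<close> is \<open>u\<close> for the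
  initial value \<open>(y, By)\<close>. The group law gives \<open>u(t + s) = C(s)u(t) + S(s)u'(t)\<close>. For \<open>z\<close> in the domain
  of the generator \<open>u'' + 2Bu' = Au\<close>, so the reversed orbit \<open>u(t - \<xi>)\<close> solves the same equation with
  forcing term \<open>-4Bu'(t - \<xi>)\<close>, and Duhamel's formula expresses \<open>u(t - s)\<close>. Integration by parts
  removes the derivative of \<open>u\<close> from the integral, and the result extends to all \<open>z\<close> by density.
  Adding and subtracting the formulas for \<open>u(t + s)\<close> and \<open>u(t - s)\<close> gives the eight identities.\<close>

section \<open>Uniform boundedness and the closed graph theorem\<close>

text \<open>Zabreiko's lemma, the common source of the two theorems below. Baire gives a ball in the
  closure of a sublevel set, symmetry moves its centre to the origin, and successive approximation
  with countable subadditivity removes the closure.\<close>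

lemma zabreiko:
  fixes p :: "'a::banach \<Rightarrow> real"
  assumes nonneg: "\<And>x. 0 \<le> p x"
    and scale: "\<And>r x. p (r *\<^sub>R x) = \<bar>r\<bar> * p x"
    and triangle: "\<And>x y. p (x + y) \<le> p x + p y"
    and countable: "\<And>f x. f sums x \<Longrightarrow> summable (\<lambda>n. p (f n)) \<Longrightarrow> p x \<le> (\<Sum>n. p (f n))"
  shows "\<exists>K. \<forall>x. p x \<le> K * norm x"
proof -
  define L where "L n = {x. p x \<le> real n}" for n :: nat
  have "\<Union>(range (\<lambda>n. closure (L n))) = UNIV"
  proof -
    have "x \<in> closure (L (nat \<lceil>p x\<rceil>))" for x
      by (rule subsetD[OF closure_subset]) (simp add: L_def real_nat_ceiling_ge)
    then show ?thesis by blast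
  qed
  \<comment> \<open>Baire: countably many closed sets with empty interior cannot cover the space,
    whereas the closures of the \<open>L n\<close> do.\<close>
  moreover have "interior (\<Union>(range (\<lambda>n. closure (L n)))) = {}"
    if empty: "\<And>n. interior (closure (L n)) = {}"
  proof -
    have "euclidean interior_of \<Union>(range (\<lambda>n. closure (L n))) = {}"
    proof (rule Met_TC.metric_Baire_category_alt[unfolded mtopology_is_euclidean])
      show "Met_TC.mcomplete (TYPE('a))"
        by (rule mcomplete_iff_complete[THEN iffD2, OF complete_UNIV])
      show "countable (range (\<lambda>n. closure (L n)))"
        by (rule countable_image) (rule countableI_type)
      fix C assume "C \<in> range (\<lambda>n. closure (L n))"
      then obtain n where C: "C = closure (L n)" by (rule rangeE)
      show "closedin euclidean C \<and> euclidean interior_of C = {}"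
        unfolding C euclidean_interior_of closed_closedin[symmetric]
        by (intro conjI closed_closure empty)
    qed
    then show ?thesis unfolding euclidean_interior_of .
  qed
  ultimately have "\<exists>n. interior (closure (L n)) \<noteq> {}"
    by (metis interior_UNIV UNIV_not_empty)
  then obtain n where "interior (closure (L n)) \<noteq> {}" ..
  then obtain a r where r: "0 < r" "ball a r \<subseteq> closure (L n)"
    by (metis ex_in_conv mem_interior)
  \<comment> \<open>Both \<open>a + x\<close> and \<open>a - x\<close> lie in the ball, so both have
    approximants in \<open>L n\<close>. Half the difference of these approximates \<open>x\<close>,
    and \<open>p\<close> of it is still at most \<open>n\<close>.\<close>
  have approx: "\<exists>y. p y \<le> real n \<and> norm (x - y) < e" if "norm x < r" "0 < e" for x e
  proof -
    have "a + x \<in> closure (L n)" "a - x \<in> closure (L n)"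
      using that r by (auto simp: subset_iff dist_norm)
    then obtain y z where yz: "y \<in> L n" "z \<in> L n" "dist y (a + x) < e" "dist z (a - x) < e"
      using \<open>0 < e\<close> by (meson closure_approachable)
    have "p (y - z) \<le> p y + p z"
      using triangle[of y "- z"] scale[of "-1" z] by simp
    then have "p ((1/2) *\<^sub>R (y - z)) \<le> real n"
      using yz by (simp add: scale L_def)
    moreover have "norm (x - (1/2) *\<^sub>R (y - z)) < e"
    proof -
      have "x - (1/2) *\<^sub>R (y - z) = (1/2) *\<^sub>R ((z - (a - x)) - (y - (a + x)))"
        by (simp add: algebra_simps) (simp flip: scaleR_left_distrib)
      then have "norm (x - (1/2) *\<^sub>R (y - z)) = norm ((z - (a - x)) - (y - (a + x))) / 2"
        by simp
      also have "\<dots> \<le> (norm (z - (a - x)) + norm (y - (a + x))) / 2"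
        using norm_triangle_ineq4 by (rule divide_right_mono) simp
      also have "\<dots> < e" using yz by (simp add: dist_norm)
      finally show ?thesis .
    qed
    ultimately show ?thesis by blast
  qed
  \<comment> \<open>Rescale \<open>x\<close> to norm \<open>r / 2\<close> and approximate it up to
    \<open>r / 4\<close>: scaling back leaves an error of half the norm of \<open>x\<close>, at cost
    \<open>n * (2 * norm x / r)\<close>.\<close>
  define K where "K = 2 * real n / r"
  have "\<exists>y. p y \<le> K * norm x \<and> norm (x - y) \<le> norm x / 2" for x
  proof (cases "x = 0")
    case True
    then show ?thesis using scale[of 0 0] by (intro exI[of _ 0]) auto
  next
    case False
    define c where "c = r / (2 * norm x)"
    have c: "c > 0" using False r by (simp add: c_def)
    have "norm (c *\<^sub>R x) < r" using False r by (simp add: c_def)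
    then obtain y where y: "p y \<le> real n" "norm (c *\<^sub>R x - y) < r / 4"
      using approx[of "c *\<^sub>R x" "r / 4"] r by auto
    have "p ((1 / c) *\<^sub>R y) \<le> (1 / c) * real n"
      using y c by (simp add: scale divide_right_mono)
    also have "\<dots> = K * norm x" using False r by (simp add: c_def K_def)
    finally have "p ((1 / c) *\<^sub>R y) \<le> K * norm x" .
    moreover have "x - (1 / c) *\<^sub>R y = (1 / c) *\<^sub>R (c *\<^sub>R x - y)"
      using c by (simp add: algebra_simps)
    then have "norm (x - (1 / c) *\<^sub>R y) \<le> (1 / c) * (r / 4)"
      using mult_left_mono[of "norm (c *\<^sub>R x - y)" "r / 4" "1 / c"] y c by simp
    then have "norm (x - (1 / c) *\<^sub>R y) \<le> norm x / 2"
      using False r by (simp add: c_def)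
    ultimately show ?thesis by blast
  qed
  then obtain g where g: "\<And>x. p (g x) \<le> K * norm x" "\<And>x. norm (x - g x) \<le> norm x / 2"
    by metis
  have K: "0 \<le> K" using r by (simp add: K_def)
  have "p x \<le> 2 * K * norm x" for x
  proof -
    \<comment> \<open>\<open>X k\<close> is the residual after \<open>k\<close> corrections. It
      halves each time, so \<open>x\<close> is the sum of the corrections \<open>g (X k)\<close>,
      whose values under \<open>p\<close> are dominated by a geometric series with sum
      \<open>2 * K * norm x\<close>.\<close>
    define X where "X k = ((\<lambda>y. y - g y) ^^ k) x" for k
    have X_Suc: "X (Suc k) = X k - g (X k)" for k by (simp add: X_def)
    have X_bound: "norm (X k) \<le> norm x * (1/2) ^ k" for k
    proof (induction k)
      case (Suc k)
      then show ?case using g(2)[of "X k"] by (simp add: X_Suc)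
    qed (simp add: X_def)
    have "(\<lambda>k. norm x * (1/2) ^ k) \<longlonglongrightarrow> 0"
      by (intro tendsto_mult_right_zero LIMSEQ_power_zero) simp
    then have "X \<longlonglongrightarrow> 0"
      by (rule Lim_null_comparison[rotated]) (use X_bound in auto)
    then have "(\<lambda>k. X k - X (Suc k)) sums (X 0 - 0)" by (rule telescope_sums')
    then have sums: "(\<lambda>k. g (X k)) sums x" by (simp add: X_Suc) (simp add: X_def)
    have geo: "(\<lambda>k. K * norm x * (1/2) ^ k) sums (K * norm x * 2)"
      using sums_mult[OF geometric_sums[of "1/2::real"], of "K * norm x"] by simp
    have bound: "p (g (X k)) \<le> K * norm x * (1/2) ^ k" for k
      using g(1)[of "X k"] mult_left_mono[OF X_bound[of k] K] by simp
    then have summable: "summable (\<lambda>k. p (g (X k)))"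
      by (intro summable_comparison_test'[OF sums_summable[OF geo]]) (simp add: nonneg)
    have "p x \<le> (\<Sum>k. p (g (X k)))" by (rule countable[OF sums summable])
    also have "\<dots> \<le> K * norm x * 2"
      using suminf_le[OF bound summable sums_summable[OF geo]] sums_unique[OF geo] by simp
    finally show ?thesis by simp
  qed
  then show ?thesis by blast
qed

text \<open>Zabreiko's lemma for the pointwise supremum \<open>p\<close>: continuity of each single
  \<open>F i\<close> gives countable subadditivity, and this passes to the supremum. The empty index
  set is split off because its supremum carries no information.\<close>

lemma uniform_boundedness:
  fixes F :: "'i \<Rightarrow> 'a::banach \<Rightarrow> 'b::banach"
  assumes lin: "\<And>i. i \<in> I \<Longrightarrow> bounded_linear (F i)"
    and bdd: "\<And>x. bdd_above ((\<lambda>i. norm (F i x)) ` I)"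
  shows "\<exists>K. \<forall>i\<in>I. \<forall>x. norm (F i x) \<le> K * norm x"
proof (cases "I = {}")
  case False
  define p where "p x = (SUP i\<in>I. norm (F i x))" for x
  have upper: "norm (F i x) \<le> p x" if "i \<in> I" for i x
    unfolding p_def by (rule cSUP_upper[OF that bdd])
  have least: "p x \<le> c" if "\<And>i. i \<in> I \<Longrightarrow> norm (F i x) \<le> c" for x c
    unfolding p_def by (rule cSUP_least[OF False that])
  have nonneg: "0 \<le> p x" for x
    using False upper norm_ge_zero order_trans by blast
  have scale_le: "p (r *\<^sub>R x) \<le> \<bar>r\<bar> * p x" for r x
    by (rule least) (simp add: lin linear_simps upper mult_left_mono)
  have "\<exists>K. \<forall>x. p x \<le> K * norm x"
  proof (rule zabreiko)
    \<comment> \<open>The supremum directly gives only one inequality; the other is the same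
      inequality for the factor \<open>1 / r\<close>.\<close>
    show "p (r *\<^sub>R x) = \<bar>r\<bar> * p x" for r x
    proof (cases "r = 0")
      case True
      then show ?thesis using scale_le[of r x] nonneg[of "r *\<^sub>R x"] by simp
    next
      case False
      have "\<bar>r\<bar> * p x \<le> p (r *\<^sub>R x)"
        using scale_le[of "1 / r" "r *\<^sub>R x"] False by (simp add: field_simps)
      with scale_le show ?thesis by (simp add: antisym)
    qed
    show "p (x + y) \<le> p x + p y" for x y
    proof (rule least)
      fix i assume i: "i \<in> I"
      have "norm (F i (x + y)) \<le> norm (F i x) + norm (F i y)"
        by (simp add: lin[OF i] linear_simps norm_triangle_ineq)
      then show "norm (F i (x + y)) \<le> p x + p y"
        using upper[OF i, of x] upper[OF i, of y] by simp
    qed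
    show "p x \<le> (\<Sum>n. p (f n))" if "f sums x" "summable (\<lambda>n. p (f n))" for f x
    proof (rule least)
      fix i assume i: "i \<in> I"
      have sums: "(\<lambda>n. F i (f n)) sums F i x"
        using bounded_linear.sums[OF lin[OF i] that(1)] .
      have abs: "summable (\<lambda>n. norm (F i (f n)))"
        by (rule summable_comparison_test'[OF that(2)]) (simp add: upper[OF i])
      have "norm (F i x) = norm (\<Sum>n. F i (f n))" using sums_unique[OF sums] by simp
      also have "\<dots> \<le> (\<Sum>n. norm (F i (f n)))" by (rule summable_norm[OF abs])
      also have "\<dots> \<le> (\<Sum>n. p (f n))" by (rule suminf_le[OF upper[OF i] abs that(2)])
      finally show "norm (F i x) \<le> (\<Sum>n. p (f n))" .
    qed
  qed (rule nonneg)
  then show ?thesis using upper order_trans by blast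
qed simp

text \<open>Zabreiko's lemma for the norm of \<open>f x\<close>: if these norms are summable along a
  series, the images converge absolutely, and closedness identifies their sum with the image of the
  sum.\<close>

lemma closed_graph:
  fixes f :: "'a::banach \<Rightarrow> 'b::banach"
  assumes lin: "linear f"
    and graph: "\<And>X x y. X \<longlonglongrightarrow> x \<Longrightarrow> (\<lambda>n. f (X n)) \<longlonglongrightarrow> y \<Longrightarrow> f x = y"
  shows "bounded_linear f"
proof -
  have "\<exists>K. \<forall>x. norm (f x) \<le> K * norm x"
  proof (rule zabreiko)
    show "norm (f (x + y)) \<le> norm (f x) + norm (f y)" for x y
      by (simp add: linear_add[OF lin] norm_triangle_ineq)
    show "norm (f x) \<le> (\<Sum>n. norm (f (g n)))"
      if g: "g sums x" and s: "summable (\<lambda>n. norm (f (g n)))" for g x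
    proof -
      have "(\<lambda>n. f (g n)) sums (\<Sum>n. f (g n))"
        using s by (simp add: summable_norm_cancel summable_sums)
      then have "f x = (\<Sum>n. f (g n))"
        using g by (intro graph[of "\<lambda>n. \<Sum>i<n. g i"]) (simp_all add: sums_def linear_sum[OF lin])
      then show ?thesis using summable_norm[OF s] by simp
    qed
  qed (simp_all add: linear_scale[OF lin])
  then obtain K where "\<And>x. norm (f x) \<le> norm x * K" by (metis mult.commute)
  then show ?thesis
    by (intro bounded_linear_intro[of f K]) (simp_all add: linear_add[OF lin] linear_scale[OF lin])
qed

section \<open>Oriented integrals and operator-valued functions\<close>

text \<open>With a base point below both endpoints the case distinction on the orientation
  disappears, so \<open>b\<close> may cross \<open>a\<close> when the integral is
  differentiated.\<close>

lemma oriented_integral_shift: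
  fixes f :: "real \<Rightarrow> 'a::banach"
  assumes cont: "continuous_on UNIV f" and "c \<le> a" "c \<le> b"
  shows "oriented_integral a b f = integral {c..b} f - integral {c..a} f"
proof -
  have int: "f integrable_on {u..v}" for u v
    by (rule integrable_continuous_interval[OF continuous_on_subset[OF cont]]) simp
  show ?thesis
    using assms Henstock_Kurzweil_Integration.integral_combine[OF _ _ int, of c a b]
      Henstock_Kurzweil_Integration.integral_combine[OF _ _ int, of c b a]
    by (auto simp: oriented_integral_def algebra_simps)
qed

lemma oriented_integral_has_vector_derivative:
  fixes f :: "real \<Rightarrow> 'a::banach"
  assumes cont: "continuous_on UNIV f"
  shows "((\<lambda>b. oriented_integral a b f) has_vector_derivative f b) (at b)"
proof -
  \<comment> \<open>The point \<open>c\<close> lies strictly below both \<open>a\<close> and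
    \<open>b\<close>, so the shifted form holds on the whole neighbourhood of \<open>b\<close>
    between \<open>c\<close> and \<open>d\<close>.\<close>
  define c d where "c = min a b - 1" and "d = b + 1"
  have "((\<lambda>b. integral {c..b} f) has_vector_derivative f b) (at b within {c..d})"
    by (rule integral_has_vector_derivative[OF continuous_on_subset[OF cont]]) (auto simp: c_def d_def)
  then have "((\<lambda>b. integral {c..b} f - integral {c..a} f) has_vector_derivative f b) (at b within {c<..<d})"
    by (auto intro!: derivative_eq_intros intro: has_vector_derivative_within_subset)
  then have "((\<lambda>b. oriented_integral a b f) has_vector_derivative f b) (at b within {c<..<d})"
    by (rule has_vector_derivative_transform[rotated 2])
      (auto simp: c_def d_def intro!: oriented_integral_shift[OF cont])
  then show ?thesis
    by (subst (asm) at_within_open) (auto simp: c_def d_def)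
qed

lemma oriented_integral_ftc:
  fixes f :: "real \<Rightarrow> 'a::banach"
  assumes "\<And>x. (F has_vector_derivative f x) (at x)"
  shows "oriented_integral a b f = F b - F a"
proof -
  have "integral {u..v} f = F v - F u" if "u \<le> v" for u v
    using that assms by (intro integral_unique fundamental_theorem_of_calculus)
      (auto intro: has_vector_derivative_at_within)
  then show ?thesis by (simp add: oriented_integral_def)
qed

lemma oriented_integral_self [simp]: "oriented_integral a a f = 0"
  by (simp add: oriented_integral_def)

text \<open>The right side is an antiderivative of the sum that vanishes at \<open>b = a\<close>,
  which avoids treating the two orientations separately. The next lemma is proved in the same
  way.\<close>

lemma oriented_integral_add:
  fixes f g :: "real \<Rightarrow> 'a::banach"
  assumes "continuous_on UNIV f" "continuous_on UNIV g"
  shows "oriented_integral a b (\<lambda>x. f x + g x) = oriented_integral a b f + oriented_integral a b g"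
  using oriented_integral_ftc[of "\<lambda>b. oriented_integral a b f + oriented_integral a b g", OF
      has_vector_derivative_add[OF assms[THEN oriented_integral_has_vector_derivative]]]
  by simp

lemma oriented_integral_linear:
  fixes f :: "real \<Rightarrow> 'a::banach" and L :: "'a \<Rightarrow> 'b::banach"
  assumes "continuous_on UNIV f" "bounded_linear L"
  shows "oriented_integral a b (\<lambda>x. L (f x)) = L (oriented_integral a b f)"
  using oriented_integral_ftc[of "\<lambda>b. L (oriented_integral a b f)", OF
      bounded_linear.has_vector_derivative[OF assms(2) oriented_integral_has_vector_derivative[OF assms(1)]]]
    linear_0[OF bounded_linear.linear[OF assms(2)]]
  by simp

lemma oriented_integral_norm_le:
  fixes f :: "real \<Rightarrow> 'a::banach"
  assumes "continuous_on UNIV f" "\<And>x. x \<in> {min a b..max a b} \<Longrightarrow> norm (f x) \<le> K"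
  shows "norm (oriented_integral a b f) \<le> K * \<bar>b - a\<bar>"
proof -
  have "norm (integral {u..v} f) \<le> K * (v - u)" if "u \<le> v" "min a b = u" "max a b = v" for u v
    using that assms by (intro integral_bound continuous_on_subset[OF assms(1)]) auto
  then show ?thesis
    by (auto simp: oriented_integral_def min_def max_def split: if_splits)
qed

section \<open>Difference quotients and the product rule for strongly continuous operators\<close>

lemma has_vector_derivative_at_iff:
  "(f has_vector_derivative f') (at x) \<longleftrightarrow> ((\<lambda>h. (f (x + h) - f x) /\<^sub>R h) \<longlongrightarrow> f') (at 0)"
proof -
  have "norm (f (x + h) - f x - h *\<^sub>R f') / norm h = norm ((f (x + h) - f x) /\<^sub>R h - f')"
    if "h \<noteq> 0" for h
  proof -
    have "(f (x + h) - f x) /\<^sub>R h - f' = (f (x + h) - f x - h *\<^sub>R f') /\<^sub>R h"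
      using that by (simp add: algebra_simps)
    then show ?thesis by (simp add: divide_inverse mult.commute)
  qed
  then have "((\<lambda>h. norm (f (x + h) - f x - h *\<^sub>R f') / norm h) \<longlongrightarrow> 0) (at 0) \<longleftrightarrow>
      ((\<lambda>h. norm ((f (x + h) - f x) /\<^sub>R h - f')) \<longlongrightarrow> 0) (at 0)"
    by (intro filterlim_cong) (auto simp: eventually_at_filter)
  then show ?thesis
    by (simp add: has_vector_derivative_def has_derivative_at bounded_linear_scaleR_left
        tendsto_norm_zero_iff LIM_zero_iff)
qed

lemma has_vector_derivative_at_iff':
  "(f has_vector_derivative f') (at x) \<longleftrightarrow> ((\<lambda>t. (f t - f x) /\<^sub>R (t - x)) \<longlongrightarrow> f') (at x)"
  unfolding has_vector_derivative_at_iff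
  using LIM_offset_zero_iff[of x "\<lambda>t. (f t - f x) /\<^sub>R (t - x)" f'] by (simp add: add.commute)

text \<open>Split \<open>V t (f t) = V t (f t - x) + V t x\<close>; the uniform bound sends the
  first term to zero, so strong convergence at the single vector \<open>x\<close> suffices.\<close>

lemma tendsto_apply_strong:
  fixes V :: "'t::topological_space \<Rightarrow> 'a::real_normed_vector \<Rightarrow> 'b::real_normed_vector"
  assumes lin: "\<And>t. bounded_linear (V t)"
    and bound: "eventually (\<lambda>t. \<forall>x. norm (V t x) \<le> K * norm x) F"
    and V: "((\<lambda>t. V t x) \<longlongrightarrow> y) F"
    and f: "(f \<longlongrightarrow> x) F"
  shows "((\<lambda>t. V t (f t)) \<longlongrightarrow> y) F"
proof -
  have "((\<lambda>t. K * norm (f t - x)) \<longlongrightarrow> 0) F"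
    by (intro tendsto_mult_right_zero tendsto_norm_zero LIM_zero f)
  then have "((\<lambda>t. V t (f t - x)) \<longlongrightarrow> 0) F"
    by (rule Lim_null_comparison[rotated]) (use bound in \<open>auto elim: eventually_mono\<close>)
  from tendsto_add[OF this V] show ?thesis
    by (simp add: lin linear_simps)
qed

text \<open>The quotient splits into that of \<open>V t (f r)\<close> and \<open>V t\<close> applied
  to the quotient of \<open>f\<close>. Differentiability of \<open>V\<close> is asked only at the
  vector \<open>f r\<close>, since group orbits are differentiable only for initial values in
  \<open>D\<close>.\<close>

lemma has_vector_derivative_apply_strong:
  fixes V :: "real \<Rightarrow> 'a::real_normed_vector \<Rightarrow> 'b::real_normed_vector"
  assumes lin: "\<And>t. bounded_linear (V t)"
    and bound: "eventually (\<lambda>t. \<forall>x. norm (V t x) \<le> K * norm x) (at r)"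
    and cont: "((\<lambda>t. V t f') \<longlongrightarrow> V r f') (at r)"
    and V: "((\<lambda>t. V t (f r)) has_vector_derivative v) (at r)"
    and f: "(f has_vector_derivative f') (at r)"
  shows "((\<lambda>t. V t (f t)) has_vector_derivative v + V r f') (at r)"
proof -
  have quot: "((\<lambda>t. (f t - f r) /\<^sub>R (t - r)) \<longlongrightarrow> f') (at r)"
    using f by (simp add: has_vector_derivative_at_iff')
  have "((\<lambda>t. (V t (f r) - V r (f r)) /\<^sub>R (t - r) + V t ((f t - f r) /\<^sub>R (t - r)))
      \<longlongrightarrow> v + V r f') (at r)"
    using V by (intro tendsto_add tendsto_apply_strong[OF lin bound cont quot])
      (simp add: has_vector_derivative_at_iff')
  then show ?thesis
    by (simp add: has_vector_derivative_at_iff' lin linear_simps algebra_simps)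
qed

section \<open>Generators of groups\<close>

locale C0_group_generator =
  fixes D :: "'a::complex_banach set" and G :: "'a \<Rightarrow> 'a" and T :: "real \<Rightarrow> 'a \<Rightarrow> 'a"
  assumes generates: "generates_C0_group D G T"
begin

lemma bounded_linear_T: "bounded_linear (T t)"
  and T_0 [simp]: "T 0 x = x"
  and T_add: "T (t + s) x = T t (T s x)"
  and continuous_T: "continuous_on UNIV (\<lambda>t. T t x)"
  using generates by (auto simp: generates_C0_group_def C0_group_def bounded_clinear_def)

lemmas T_simps = linear_simps[OF bounded_linear_T]

text \<open>Each orbit is continuous, hence bounded on the compact interval, and uniform boundedness
  applies.\<close>

lemma T_bounded: "\<exists>K. \<forall>t\<in>{-R..R}. \<forall>x. norm (T t x) \<le> K * norm x"
proof (rule uniform_boundedness[OF bounded_linear_T])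
  fix x
  have "compact ((\<lambda>t. norm (T t x)) ` {-R..R})"
    by (intro compact_continuous_image continuous_on_norm continuous_on_subset[OF continuous_T]) auto
  then show "bdd_above ((\<lambda>t. norm (T t x)) ` {-R..R})"
    by (intro bounded_imp_bdd_above compact_imp_bounded)
qed

lemma T_eventually_bounded:
  fixes g :: "real \<Rightarrow> real"
  assumes "isCont g r"
  shows "\<exists>K. eventually (\<lambda>t. \<forall>x. norm (T (g t) x) \<le> K * norm x) (at r)"
proof -
  obtain K where K: "\<forall>t\<in>{-(\<bar>g r\<bar> + 1)..\<bar>g r\<bar> + 1}. \<forall>x. norm (T t x) \<le> K * norm x"
    using T_bounded by blast
  have "eventually (\<lambda>t. dist (g t) (g r) < 1) (at r)"
    using assms by (intro tendstoD) (auto simp: isCont_def)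
  then have "eventually (\<lambda>t. \<forall>x. norm (T (g t) x) \<le> K * norm x) (at r)"
  proof eventually_elim
    case (elim t)
    then have "g t \<in> {-(\<bar>g r\<bar> + 1)..\<bar>g r\<bar> + 1}" by (auto simp: dist_real_def)
    with K show ?case by blast
  qed
  then show ?thesis ..
qed

lemma continuous_T_apply:
  fixes g :: "real \<Rightarrow> real"
  assumes g: "continuous_on UNIV g" and f: "continuous_on UNIV f"
  shows "continuous_on UNIV (\<lambda>t. T (g t) (f t))"
proof -
  have "isCont (\<lambda>t. T (g t) (f t)) r" for r
  proof -
    have cont: "isCont g r" "isCont f r"
      using g f by (auto simp: continuous_on_eq_continuous_at)
    obtain K where K: "eventually (\<lambda>t. \<forall>x. norm (T (g t) x) \<le> K * norm x) (at r)"
      using T_eventually_bounded[OF cont(1)] ..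
    have "continuous_on UNIV (\<lambda>t. T (g t) (f r))"
      by (rule continuous_on_compose2[OF continuous_T g]) simp
    then have lim: "((\<lambda>t. T (g t) (f r)) \<longlongrightarrow> T (g r) (f r)) (at r)"
      by (simp add: continuous_on_eq_continuous_at isCont_def)
    show ?thesis
      using tendsto_apply_strong[OF bounded_linear_T K lim cont(2)[unfolded isCont_def]]
      by (simp add: isCont_def)
  qed
  then show ?thesis by (simp add: continuous_on_eq_continuous_at)
qed

lemma in_D_iff: "z \<in> D \<longleftrightarrow> (\<exists>y. ((\<lambda>h. (T h z - z) /\<^sub>R h) \<longlongrightarrow> y) (at 0))"
  and G_tendsto: "z \<in> D \<Longrightarrow> ((\<lambda>h. (T h z - z) /\<^sub>R h) \<longlongrightarrow> G z) (at 0)"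
  using generates by (auto simp: generates_C0_group_def)

lemma G_eqI:
  assumes "((\<lambda>h. (T h z - z) /\<^sub>R h) \<longlongrightarrow> y) (at 0)"
  shows "z \<in> D" "G z = y"
  using assms in_D_iff tendsto_unique[OF _ G_tendsto assms] by auto

text \<open>\<open>T t\<close> is continuous and commutes with the difference quotients at
  zero.\<close>

lemma T_in_D:
  assumes "z \<in> D"
  shows "T t z \<in> D" and "G (T t z) = T t (G z)"
proof -
  have "((\<lambda>h. T t ((T h z - z) /\<^sub>R h)) \<longlongrightarrow> T t (G z)) (at 0)"
    by (rule bounded_linear.tendsto[OF bounded_linear_T G_tendsto[OF assms]])
  then have "((\<lambda>h. (T h (T t z) - T t z) /\<^sub>R h) \<longlongrightarrow> T t (G z)) (at 0)"
    by (simp add: T_simps add.commute flip: T_add)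
  then show "T t z \<in> D" "G (T t z) = T t (G z)" by (rule G_eqI)+
qed

lemma T_has_vector_derivative:
  assumes "z \<in> D"
  shows "((\<lambda>t. T t z) has_vector_derivative T t (G z)) (at t)"
  using G_tendsto[OF T_in_D(1)[OF assms], of t]
  by (simp add: has_vector_derivative_at_iff T_in_D(2)[OF assms] add.commute flip: T_add)

text \<open>Integrated orbits lie in \<open>D\<close> for every initial value. This transfers facts
  about the generator to arbitrary \<open>z\<close>.\<close>

lemma integral_in_D:
  defines "F \<equiv> \<lambda>z h. oriented_integral 0 h (\<lambda>t. T t z)"
  shows "F z h \<in> D" and "G (F z h) = T h z - z"
    and "(F z has_vector_derivative T h z) (at h)"
proof -
  show deriv: "(F z has_vector_derivative T h z) (at h)" for h
    unfolding F_def by (rule oriented_integral_has_vector_derivative[OF continuous_T])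
  \<comment> \<open>\<open>T k\<close> shifts the window of integration from \<open>[0, h]\<close>
    to \<open>[k, h + k]\<close>, so the difference quotient of \<open>F z h\<close> becomes one at
    \<open>h\<close> minus one at \<open>0\<close>.\<close>
  have shift: "T k (F z h) = F z (h + k) - F z k" for h k
  proof -
    have "((\<lambda>h. F z (h + k)) has_vector_derivative T (h + k) z) (at h)" for h
    proof -
      have "((\<lambda>h. h + k) has_vector_derivative 1) (at h)"
        by (auto intro!: derivative_eq_intros)
      from vector_diff_chain_at[OF this deriv] show ?thesis by (simp add: o_def)
    qed
    then have "oriented_integral 0 h (\<lambda>h. T (h + k) z) = F z (h + k) - F z (0 + k)"
      by (rule oriented_integral_ftc)
    then show ?thesis
      by (simp add: F_def oriented_integral_linear[OF continuous_T bounded_linear_T] add.commute[of _ k] T_add)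
  qed
  have "((\<lambda>k. (F z (h + k) - F z h) /\<^sub>R k - (F z (0 + k) - F z 0) /\<^sub>R k) \<longlongrightarrow> T h z - T 0 z) (at 0)"
    using deriv by (intro tendsto_diff) (simp_all only: has_vector_derivative_at_iff)
  moreover have "F z 0 = 0" by (simp add: F_def)
  ultimately have "((\<lambda>k. (T k (F z h) - F z h) /\<^sub>R k) \<longlongrightarrow> T h z - z) (at 0)"
    by (simp add: shift algebra_simps)
  then show "F z h \<in> D" "G (F z h) = T h z - z" by (rule G_eqI)+
qed

lemma D_scaleR: "z \<in> D \<Longrightarrow> r *\<^sub>R z \<in> D"
  using bounded_linear.tendsto[OF bounded_linear_scaleR_right G_tendsto, of z r]
  by (intro G_eqI(1)) (simp add: T_simps algebra_simps)

text \<open>The averages of an orbit over \<open>[0, h]\<close> lie in \<open>D\<close> and tend to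
  its initial value.\<close>

lemma dense_D: "closure D = UNIV"
proof -
  have "z \<in> closure D" for z
  proof -
    define F where "F h = oriented_integral 0 h (\<lambda>t. T t z)" for h
    have "((\<lambda>h. F h /\<^sub>R h) \<longlongrightarrow> z) (at 0)"
      using integral_in_D(3)[of z 0] by (simp add: has_vector_derivative_at_iff F_def)
    moreover have "F h /\<^sub>R h \<in> closure D" for h
      unfolding F_def by (intro subsetD[OF closure_subset] D_scaleR integral_in_D(1))
    ultimately show ?thesis
      by (intro Lim_in_closed_set[OF closed_closure]) (auto simp: trivial_limit_at)
  qed
  then show ?thesis by auto
qed

end

section \<open>The orbits of the operator matrix group\<close>

locale operator_matrix_group =
  fixes A B :: "'x \<Rightarrow> 'x::complex_banach"
    and DA DB :: "'x set"
    and j :: "'y::complex_banach \<Rightarrow> 'x"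
    and T :: "real \<Rightarrow> 'y \<times> 'x \<Rightarrow> 'y \<times> 'x"
  assumes A: "closed_operator DA A"
    and B: "closed_operator DB B"
    and j: "continuous_embedding j"
    and DA: "DA \<subseteq> {x \<in> DB. B x \<in> DB} \<inter> range j"
    and B_DA: "B ` DA \<subseteq> range j"
    and range_j: "range j \<subseteq> DB"
    and gen: "generates_C0_group (G_dom j DA) (G_op j A B) T"
begin

abbreviation "D \<equiv> G_dom j DA"
abbreviation "G \<equiv> G_op j A B"

sublocale C0_group_generator D G T
  by unfold_locales (rule gen)

lemma bounded_linear_j: "bounded_linear j" and inj_j: "inj j"
  using j by (auto simp: continuous_embedding_def bounded_clinear_def)

lemmas j_simps = linear_simps[OF bounded_linear_j]

lemma j_in_DB: "j y \<in> DB"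
  using range_j by auto

lemma B_add: "x \<in> DB \<Longrightarrow> y \<in> DB \<Longrightarrow> B (x + y) = B x + B y"
  and B_scaleR: "x \<in> DB \<Longrightarrow> B (r *\<^sub>R x) = r *\<^sub>R B x"
  and DB_add: "x \<in> DB \<Longrightarrow> y \<in> DB \<Longrightarrow> x + y \<in> DB"
  and DB_scaleR: "x \<in> DB \<Longrightarrow> r *\<^sub>R x \<in> DB"
  using B by (auto simp: closed_operator_def simp flip: scaleC_of_real)

lemma B_diff: "x \<in> DB \<Longrightarrow> y \<in> DB \<Longrightarrow> B (x - y) = B x - B y"
  using B_add[of x "(-1) *\<^sub>R y"] B_scaleR[of y "-1"] DB_scaleR[of y "-1"] by simp

text \<open>\<open>B\<close> is closed and defined on all of \<open>range j\<close>, so the closed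
  graph theorem makes it bounded in the norm of \<open>Y\<close>. Hence \<open>B\<close> may be
  applied to limits, derivatives and integrals taken in \<open>Y\<close>.\<close>

lemma bounded_linear_Bj: "bounded_linear (\<lambda>y. B (j y))"
proof (rule closed_graph)
  show "linear (\<lambda>y. B (j y))"
    by (rule linearI) (simp_all add: j_simps B_add B_scaleR j_in_DB)
next
  fix X x y assume X: "X \<longlonglongrightarrow> x" and BX: "(\<lambda>n. B (j (X n))) \<longlonglongrightarrow> y"
  have "(\<lambda>n. (j (X n), B (j (X n)))) \<longlonglongrightarrow> (j x, y)"
    by (intro tendsto_Pair BX bounded_linear.tendsto[OF bounded_linear_j X])
  moreover have "closed ((\<lambda>x. (x, B x)) ` DB)"
    using B by (simp add: closed_operator_def)
  ultimately have "(j x, y) \<in> (\<lambda>x. (x, B x)) ` DB"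
    by (rule closed_sequentially[rotated 2]) (use j_in_DB in auto)
  then show "B (j x) = y" by auto
qed

lemmas Bj_simps = linear_simps[OF bounded_linear_Bj]

section \<open>Position and velocity along an orbit\<close>

definition pos :: "real \<Rightarrow> 'y \<times> 'x \<Rightarrow> 'x" where
  "pos t z = j (fst (T t z))"

definition vel :: "real \<Rightarrow> 'y \<times> 'x \<Rightarrow> 'x" where
  "vel t z = snd (T t z) - B (pos t z)"

text \<open>On the domain both \<open>B (j y)\<close> and \<open>x\<close> lie in
  \<open>range j\<close>, so \<open>inv j\<close> in the first row of the matrix is a genuine
  inverse.\<close>

lemma j_fst_G:
  assumes "z \<in> D"
  shows "j (fst (G z)) = snd z - B (j (fst z))"
proof -
  obtain y x where z: "z = (y, x)" by force
  with assms have "j y \<in> DA" "x \<in> range j" by (auto simp: G_dom_def)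
  then obtain a b where "B (j y) = j a" "x = j b" using B_DA by auto
  then have "- B (j y) + x = j (b - a)" by (simp add: j_simps)
  then show ?thesis
    using z by (simp add: G_op_def inv_f_f[OF inj_j])
qed

text \<open>For \<open>z\<close> in \<open>D\<close> the velocity is itself a position, hence lies
  in \<open>range j\<close>; this gives \<open>B (vel t z)\<close> its meaning and its continuity in
  \<open>t\<close>.\<close>

lemma pos_G: "z \<in> D \<Longrightarrow> pos t (G z) = vel t z"
  by (simp add: pos_def vel_def j_fst_G T_in_D flip: T_in_D(2))

text \<open>Valid for all \<open>z\<close>, although the orbit in the product space need not be
  differentiable: the first row of \<open>G (F h) = T h z - z\<close> expresses the position through
  bounded operators on the differentiable \<open>F\<close>.\<close>

lemma pos_has_vector_derivative: "((\<lambda>t. pos t z) has_vector_derivative vel t z) (at t)"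
proof -
  define F where "F h = oriented_integral 0 h (\<lambda>t. T t z)" for h
  have "j (fst (T h z)) = j (fst z) + (snd (F h) - B (j (fst (F h))))" for h
    using j_fst_G[OF integral_in_D(1)[of h z]]
    by (simp add: integral_in_D(2) F_def j_simps diff_eq_eq add.commute)
  moreover have F: "(F has_vector_derivative T t z) (at t)"
    unfolding F_def by (rule integral_in_D(3))
  have "((\<lambda>h. j (fst z) + (snd (F h) - B (j (fst (F h))))) has_vector_derivative
      0 + (snd (T t z) - B (j (fst (T t z))))) (at t)"
    by (intro has_vector_derivative_add has_vector_derivative_const has_vector_derivative_diff
        bounded_linear.has_vector_derivative[OF bounded_linear_snd F]
        bounded_linear.has_vector_derivative[OF bounded_linear_Bj]
        bounded_linear.has_vector_derivative[OF bounded_linear_fst F])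
  ultimately show ?thesis by (simp add: pos_def vel_def)
qed

lemma bounded_linear_pos: "bounded_linear (pos t)"
  unfolding pos_def
  by (intro bounded_linear_compose[OF bounded_linear_j] bounded_linear_compose[OF bounded_linear_fst] bounded_linear_T)

lemma bounded_linear_Bpos: "bounded_linear (\<lambda>z. B (pos t z))"
  unfolding pos_def
  by (intro bounded_linear_compose[OF bounded_linear_Bj] bounded_linear_compose[OF bounded_linear_fst] bounded_linear_T)

lemma bounded_linear_vel: "bounded_linear (vel t)"
  unfolding vel_def
  by (intro bounded_linear_sub bounded_linear_Bpos bounded_linear_compose[OF bounded_linear_snd] bounded_linear_T)

lemmas pos_simps = linear_simps[OF bounded_linear_pos]
lemmas Bpos_simps = linear_simps[OF bounded_linear_Bpos]
lemmas vel_simps = linear_simps[OF bounded_linear_vel]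

section \<open>Initial values of the sine and cosine families\<close>

lemma zero_in_DA: "0 \<in> DA" and A_zero: "A 0 = 0" and B_zero: "B 0 = 0"
proof -
  have "A (0 + 0) = A 0 + A 0" "0 \<in> DA" using A unfolding closed_operator_def by blast+
  then show "A 0 = 0" "0 \<in> DA" by auto
  show "B 0 = 0" using Bj_simps(3) j_simps(3) by simp
qed

lemma sine_data: "(0, j y) \<in> D" "G (0, j y) = (y, - B (j y))"
  using zero_in_DA by (auto simp: G_dom_def G_op_def A_zero B_zero j_simps inv_f_f[OF inj_j])

lemma cosine_data: "j y \<in> DA \<Longrightarrow> (y, B (j y)) \<in> D"
  using B_DA by (auto simp: G_dom_def)

lemma gen_sine_eq: "gen_sine j T t x = pos t (0, x)"
  by (simp add: gen_sine_def T12_def pos_def)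

lemma strong_deriv_sine: "strong_deriv (gen_sine j T) t x = vel t (0, x)"
  by (simp add: strong_deriv_def gen_sine_eq vector_derivative_at[OF pos_has_vector_derivative])

text \<open>The first two terms of the cosine form the velocity for \<open>(0, j y)\<close>, which
  is the position for \<open>G (0, j y) = (y, - B (j y))\<close>. The third term turns the sign of
  the second entry.\<close>

lemma gen_cosine_eq: "gen_cosine j B T t (j y) = pos t (y, B (j y))"
proof -
  have "gen_cosine j B T t (j y) = pos t (G (0, j y)) + 2 *\<^sub>R pos t (0, B (j y))"
    unfolding pos_G[OF sine_data(1)]
    by (simp add: gen_cosine_def T12_def T22_def pos_def vel_def)
  also have "\<dots> = pos t (y, B (j y))"
    by (simp add: sine_data(2) scaleR_2 flip: pos_simps)
  finally show ?thesis .
qed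

lemma strong_deriv_cosine: "strong_deriv (gen_cosine j B T) t (j y) = vel t (y, B (j y))"
  by (simp add: strong_deriv_def gen_cosine_eq vector_derivative_at[OF pos_has_vector_derivative])

section \<open>Time reversal and Duhamel's formula\<close>

text \<open>Replacing \<open>(y, x)\<close> by \<open>(y, 2By - x)\<close> keeps the position and
  negates the velocity \<open>x - By\<close>. The first summand is the derivative of the reversed
  orbit, the second the defect that becomes the forcing term.\<close>

lemma backward_data:
  assumes "z \<in> D"
  shows "(fst z, 2 *\<^sub>R B (j (fst z)) - snd z) \<in> D"
    and "G (fst z, 2 *\<^sub>R B (j (fst z)) - snd z) =
      (- fst (G z), snd (G z) - 2 *\<^sub>R B (j (fst (G z)))) + (0, 4 *\<^sub>R B (j (fst (G z))))"
proof -
  obtain y x where z: "z = (y, x)" by force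
  with assms have y: "j y \<in> DA" and x: "x \<in> range j" by (auto simp: G_dom_def)
  then obtain a b where ab: "B (j y) = j a" "x = j b" using B_DA by auto
  show D: "(fst z, 2 *\<^sub>R B (j (fst z)) - snd z) \<in> D"
    using y by (auto simp: z G_dom_def ab simp flip: j_simps)
  have G: "G z = (b - a, A (j y) + B (j a) - B (j b))"
    by (simp add: z G_op_def ab inv_f_f[OF inj_j] flip: j_simps)
  have "inv j (- j a + (2 *\<^sub>R j a - j b)) = a - b"
    by (simp add: scaleR_2 inv_f_f[OF inj_j] flip: j_simps)
  moreover have four: "4 *\<^sub>R u = u + u + u + u" for u :: 'x
    using scaleR_add_left[of 2 2 u] by (simp add: scaleR_2)
  ultimately show "G (fst z, 2 *\<^sub>R B (j (fst z)) - snd z) =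
      (- fst (G z), snd (G z) - 2 *\<^sub>R B (j (fst (G z)))) + (0, 4 *\<^sub>R B (j (fst (G z))))"
    unfolding G four
    by (simp add: z G_op_def ab j_simps B_diff B_add DB_add j_in_DB scaleR_2 algebra_simps)
qed

text \<open>Duhamel's formula for the time reversal of an orbit: \<open>p(\<xi>) = u(t - \<xi>)\<close> solves
  \<open>p'' + 2Bp' = Ap - 4Bu'(t - \<xi>)\<close> if \<open>u'' + 2Bu' = Au\<close>.\<close>

lemma pos_backward_D:
  assumes z: "z \<in> D"
  shows "pos (t - s) z = pos s (fst (T t z), 2 *\<^sub>R B (pos t z) - snd (T t z))
    - 4 *\<^sub>R oriented_integral 0 s (\<lambda>\<xi>. pos (s - \<xi>) (0, B (vel (t - \<xi>) z)))"
proof -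
  \<comment> \<open>\<open>P\<close> is the reversed orbit, \<open>P'\<close> its derivative, and
    \<open>g\<close> the Duhamel integrand up to the factor 4.\<close>
  define P where "P \<xi> = (fst (T (t - \<xi>) z), 2 *\<^sub>R B (pos (t - \<xi>) z) - snd (T (t - \<xi>) z))" for \<xi>
  define P' where "P' \<xi> = (- fst (T (t - \<xi>) (G z)),
      snd (T (t - \<xi>) (G z)) - 2 *\<^sub>R B (pos (t - \<xi>) (G z)))" for \<xi>
  define g where "g \<xi> = T (s - \<xi>) (0, B (vel (t - \<xi>) z))" for \<xi>
  have refl: "((\<lambda>\<xi>. c - \<xi>) has_vector_derivative - 1) (at r)" for c r :: real
    by (auto intro!: derivative_eq_intros)
  have P_deriv: "(P has_vector_derivative P' r) (at r)" for r
  proof -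
    have Z: "((\<lambda>\<xi>. T (t - \<xi>) z) has_vector_derivative - T (t - r) (G z)) (at r)"
      using vector_diff_chain_at[OF refl T_has_vector_derivative[OF z]] by (simp add: o_def)
    have L: "bounded_linear (\<lambda>z. (fst z, 2 *\<^sub>R B (j (fst z)) - snd z))"
      by (intro bounded_linear_Pair bounded_linear_sub bounded_linear_fst bounded_linear_snd
          bounded_linear_compose[OF bounded_linear_scaleR_right]
          bounded_linear_compose[OF bounded_linear_Bj bounded_linear_fst])
    show ?thesis
      using bounded_linear.has_vector_derivative[OF L Z]
      by (simp add: P_def[abs_def] P'_def pos_def Bj_simps)
  qed
  have P_D: "P r \<in> D" and G_P: "G (P r) = P' r + (0, 4 *\<^sub>R B (vel (t - r) z))" for r
    using backward_data[OF T_in_D(1)[OF z, of "t - r"]]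
    by (simp_all add: P_def P'_def pos_def T_in_D(2)[OF z] flip: pos_G[OF z])
  \<comment> \<open>By the product rule the derivative is \<open>T (s - \<xi>)\<close> applied to
    \<open>P' - G P\<close>, so only the defect survives. The endpoint values are \<open>P s\<close>
    and \<open>T s (P 0)\<close>.\<close>
  have "((\<lambda>\<xi>. T (s - \<xi>) (P \<xi>)) has_vector_derivative - 4 *\<^sub>R g r) (at r)" for r
  proof -
    have cont: "isCont (\<lambda>\<xi>. s - \<xi>) r" by simp
    obtain K where K: "eventually (\<lambda>\<xi>. \<forall>x. norm (T (s - \<xi>) x) \<le> K * norm x) (at r)"
      using T_eventually_bounded[OF cont] ..
    have "continuous_on UNIV (\<lambda>\<xi>. T (s - \<xi>) (P' r))"
      by (intro continuous_T_apply continuous_intros)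
    then have c: "((\<lambda>\<xi>. T (s - \<xi>) (P' r)) \<longlongrightarrow> T (s - r) (P' r)) (at r)"
      by (simp add: continuous_on_def)
    have d: "((\<lambda>\<xi>. T (s - \<xi>) (P r)) has_vector_derivative - T (s - r) (G (P r))) (at r)"
      using vector_diff_chain_at[OF refl T_has_vector_derivative[OF P_D]] by (simp add: o_def)
    have "- T (s - r) (G (P r)) + T (s - r) (P' r) = - T (s - r) (4 *\<^sub>R (0, B (vel (t - r) z)))"
      by (simp add: G_P T_simps)
    also have "\<dots> = - 4 *\<^sub>R g r" by (simp only: T_simps g_def) simp
    finally show ?thesis
      using has_vector_derivative_apply_strong[OF bounded_linear_T K c d P_deriv] by simp
  qed
  then have ftc: "oriented_integral 0 s (\<lambda>\<xi>. - 4 *\<^sub>R g \<xi>) = P s - T s (P 0)"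
    using oriented_integral_ftc[of "\<lambda>\<xi>. T (s - \<xi>) (P \<xi>)" "\<lambda>\<xi>. - 4 *\<^sub>R g \<xi>" 0 s] by simp
  \<comment> \<open>Writing the velocity as the position for \<open>G z\<close> reduces continuity
    to boundedness of \<open>B\<close> after \<open>j\<close>.\<close>
  have cont_g: "continuous_on UNIV g"
    unfolding g_def pos_G[OF z, symmetric] pos_def
    by (intro continuous_T_apply continuous_on_Pair continuous_on_const continuous_on_diff
        continuous_on_id continuous_on_fst bounded_linear.continuous_on[OF bounded_linear_Bj])
  have "- 4 *\<^sub>R j (fst (oriented_integral 0 s g)) = j (fst (P s - T s (P 0)))"
    unfolding ftc[symmetric] oriented_integral_linear[OF cont_g bounded_linear_scaleR_right]
    by (simp only: fst_scaleR j_simps)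
  also have "j (fst (oriented_integral 0 s g)) = oriented_integral 0 s (\<lambda>\<xi>. j (fst (g \<xi>)))"
    by (rule oriented_integral_linear[OF cont_g, symmetric])
      (intro bounded_linear_compose[OF bounded_linear_j] bounded_linear_fst)
  finally show ?thesis
    by (simp add: P_def g_def pos_def j_simps algebra_simps)
qed

lemma bounded_linear_j_fst: "bounded_linear (\<lambda>z::'y \<times> 'x. j (fst z))"
  and bounded_linear_Bj_fst: "bounded_linear (\<lambda>z::'y \<times> 'x. B (j (fst z)))"
  and bounded_linear_snd_Bj: "bounded_linear (\<lambda>z::'y \<times> 'x. snd z - B (j (fst z)))"
  by (intro bounded_linear_sub bounded_linear_snd bounded_linear_compose[OF bounded_linear_j]
      bounded_linear_compose[OF bounded_linear_Bj] bounded_linear_fst)+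

lemma continuous_pos:
  fixes g :: "real \<Rightarrow> real"
  assumes "continuous_on UNIV g" "continuous_on UNIV f"
  shows "continuous_on UNIV (\<lambda>\<xi>. pos (g \<xi>) (f \<xi>))" "continuous_on UNIV (\<lambda>\<xi>. B (pos (g \<xi>) (f \<xi>)))"
    "continuous_on UNIV (\<lambda>\<xi>. vel (g \<xi>) (f \<xi>))"
proof -
  note T = continuous_T_apply[OF assms]
  show "continuous_on UNIV (\<lambda>\<xi>. pos (g \<xi>) (f \<xi>))" "continuous_on UNIV (\<lambda>\<xi>. B (pos (g \<xi>) (f \<xi>)))"
    "continuous_on UNIV (\<lambda>\<xi>. vel (g \<xi>) (f \<xi>))"
    unfolding vel_def pos_def
    by (rule bounded_linear.continuous_on[OF bounded_linear_j_fst T]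
        bounded_linear.continuous_on[OF bounded_linear_Bj_fst T]
        bounded_linear.continuous_on[OF bounded_linear_snd_Bj T])+
qed

section \<open>Integration by parts and extension by density\<close>

text \<open>Integrates the \<xi>-derivative of
  \<open>pos (s - \<xi>) (0, B (pos (t - \<xi>) z))\<close>, which is minus the sum of the two
  integrands.\<close>

lemma oriented_integral_parts:
  assumes z: "z \<in> D"
  shows "oriented_integral 0 s (\<lambda>\<xi>. vel (s - \<xi>) (0, B (pos (t - \<xi>) z))) =
    pos s (0, B (pos t z)) - oriented_integral 0 s (\<lambda>\<xi>. pos (s - \<xi>) (0, B (vel (t - \<xi>) z)))"
proof -
  define V where "V \<xi> x = pos (s - \<xi>) (0, x)" for \<xi> x
  define a where "a \<xi> = vel (s - \<xi>) (0, B (pos (t - \<xi>) z))" for \<xi>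
  define b where "b \<xi> = pos (s - \<xi>) (0, B (vel (t - \<xi>) z))" for \<xi>
  have refl: "((\<lambda>\<xi>. c - \<xi>) has_vector_derivative - 1) (at r)" for c r :: real
    by (auto intro!: derivative_eq_intros)
  have cont_diff: "continuous_on UNIV (\<lambda>\<xi>. c - \<xi>)" for c :: real
    by (intro continuous_intros)
  have V: "bounded_linear (V \<xi>)" for \<xi>
    unfolding V_def
    by (intro bounded_linear_compose[OF bounded_linear_pos] bounded_linear_Pair bounded_linear_zero bounded_linear_ident)
  have "((\<lambda>\<xi>. V \<xi> (B (pos (t - \<xi>) z))) has_vector_derivative - 1 *\<^sub>R (a r + b r)) (at r)" for r
  proof -
    have cont: "isCont (\<lambda>\<xi>. s - \<xi>) r" by simp
    obtain K where K: "eventually (\<lambda>\<xi>. \<forall>x. norm (T (s - \<xi>) x) \<le> K * norm x) (at r)"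
      using T_eventually_bounded[OF cont] ..
    obtain M where M: "0 < M" "\<And>z::'y \<times> 'x. norm (j (fst z)) \<le> norm z * M"
      using bounded_linear.pos_bounded[OF bounded_linear_j_fst] by blast
    have bound: "eventually (\<lambda>\<xi>. \<forall>x. norm (V \<xi> x) \<le> (K * M) * norm x) (at r)"
      using K
    proof eventually_elim
      case (elim \<xi>)
      have "norm (V \<xi> x) \<le> (K * M) * norm x" for x
      proof -
        have "norm (V \<xi> x) \<le> norm (T (s - \<xi>) (0, x)) * M"
          unfolding V_def pos_def by (rule M)
        also have "\<dots> \<le> (K * norm (0::'y, x)) * M"
          by (rule mult_right_mono[OF elim[THEN spec] less_imp_le[OF M(1)]])
        finally show ?thesis by (simp add: ac_simps)
      qed
      then show ?case ..
    qed
    have c: "((\<lambda>\<xi>. V \<xi> x) \<longlongrightarrow> V r x) (at r)" for x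
      using continuous_pos(1)[OF cont_diff continuous_on_const]
      by (simp add: V_def continuous_on_def)
    have d: "((\<lambda>\<xi>. V \<xi> x) has_vector_derivative - vel (s - r) (0, x)) (at r)" for x
      using vector_diff_chain_at[OF refl[where c = s and r = r] pos_has_vector_derivative[where z = "(0, x)"]]
      by (simp add: o_def V_def)
    have "((\<lambda>\<xi>. T (t - \<xi>) z) has_vector_derivative - T (t - r) (G z)) (at r)"
      using vector_diff_chain_at[OF refl T_has_vector_derivative[OF z]] by (simp add: o_def)
    from bounded_linear.has_vector_derivative[OF bounded_linear_Bj_fst this]
    have "((\<lambda>\<xi>. B (pos (t - \<xi>) z)) has_vector_derivative - B (vel (t - r) z)) (at r)"
      by (simp add: pos_def Bj_simps flip: pos_G[OF z])
    from has_vector_derivative_apply_strong[OF V bound c d this]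
    show ?thesis
      by (simp add: a_def b_def linear_simps[OF V]) (simp add: V_def)
  qed
  then have "oriented_integral 0 s (\<lambda>r. - 1 *\<^sub>R (a r + b r)) =
      V s (B (pos (t - s) z)) - V 0 (B (pos (t - 0) z))"
    by (rule oriented_integral_ftc)
  moreover have cont_a: "continuous_on UNIV a"
    unfolding a_def
    by (intro continuous_pos cont_diff continuous_on_Pair continuous_on_const)
  moreover have cont_b: "continuous_on UNIV b"
    unfolding b_def pos_G[OF z, symmetric]
    by (intro continuous_pos cont_diff continuous_on_Pair continuous_on_const)
  \<comment> \<open>At \<xi> \<open>= s\<close> the group is the identity and the first entry of
    \<open>(0, x)\<close> is zero, so only the boundary term at \<xi> \<open>= 0\<close>
    remains.\<close>
  moreover have "V s x = 0" for x
    by (simp add: V_def pos_def j_simps)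
  ultimately have "- 1 *\<^sub>R (oriented_integral 0 s a + oriented_integral 0 s b) = - pos s (0, B (pos t z))"
    by (simp only: oriented_integral_linear[OF continuous_on_add[OF cont_a cont_b] bounded_linear_scaleR_right]
        oriented_integral_add) (simp add: V_def)
  then show ?thesis
    unfolding a_def b_def by (simp add: algebra_simps)
qed

lemma bounded_linear_T_bounded:
  assumes L: "bounded_linear L"
  shows "\<exists>K\<ge>0. \<forall>r\<in>{-R..R}. \<forall>z. norm (L (T r z)) \<le> K * norm z"
proof -
  obtain K where K: "\<forall>r\<in>{-R..R}. \<forall>z. norm (T r z) \<le> K * norm z"
    using T_bounded by blast
  obtain M where M: "0 \<le> M" "\<And>z. norm (L z) \<le> norm z * M"
    using bounded_linear.nonneg_bounded[OF L] by blast
  have "norm (L (T r z)) \<le> (M * \<bar>K\<bar>) * norm z" if "r \<in> {-R..R}" for r z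
  proof -
    have "norm (T r z) \<le> K * norm z" using K that by blast
    also have "\<dots> \<le> \<bar>K\<bar> * norm z" by (rule mult_right_mono) auto
    finally have "norm (T r z) * M \<le> (\<bar>K\<bar> * norm z) * M"
      using M by (intro mult_right_mono)
    with M(2)[of "T r z"] show ?thesis by (simp add: ac_simps)
  qed
  then show ?thesis using M by (intro exI[of _ "M * \<bar>K\<bar>"]) auto
qed

text \<open>After integration by parts \<open>B\<close> acts on positions only, so both sides are
  bounded linear in \<open>z\<close>; they agree on the dense set \<open>D\<close>, hence
  everywhere.\<close>

lemma pos_backward:
  "pos (t - s) z = pos s (fst (T t z), 2 *\<^sub>R B (pos t z) - snd (T t z))
    + 4 *\<^sub>R oriented_integral 0 s (\<lambda>\<xi>. vel (s - \<xi>) (0, B (pos (t - \<xi>) z)))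
    - 4 *\<^sub>R pos s (0, B (pos t z))"
proof -
  define h where "h z \<xi> = vel (s - \<xi>) (0, B (pos (t - \<xi>) z))" for z \<xi>
  define rhs where "rhs z = pos s (fst (T t z), 2 *\<^sub>R B (pos t z) - snd (T t z))
    + 4 *\<^sub>R oriented_integral 0 s (h z) - 4 *\<^sub>R pos s (0, B (pos t z))" for z
  have cont_h: "continuous_on UNIV (h z)" for z
    unfolding h_def by (intro continuous_pos continuous_on_Pair continuous_intros)
  have h_linear: "h (y + z) = (\<lambda>\<xi>. h y \<xi> + h z \<xi>)" "h (r *\<^sub>R z) = (\<lambda>\<xi>. r *\<^sub>R h z \<xi>)" for y z r
  proof -
    have "(0::'y, B (pos (t - \<xi>) (y + z))) = (0, B (pos (t - \<xi>) y)) + (0, B (pos (t - \<xi>) z))"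
      "(0::'y, B (pos (t - \<xi>) (r *\<^sub>R z))) = r *\<^sub>R (0, B (pos (t - \<xi>) z))" for \<xi>
      by (simp_all add: Bpos_simps)
    then show "h (y + z) = (\<lambda>\<xi>. h y \<xi> + h z \<xi>)" "h (r *\<^sub>R z) = (\<lambda>\<xi>. r *\<^sub>R h z \<xi>)"
      unfolding h_def by (simp_all only: vel_simps)
  qed
  \<comment> \<open>Large enough for all times \<open>s - \<xi>\<close> and \<open>t - \<xi>\<close>
    with \<xi> between \<open>0\<close> and \<open>s\<close>; the resulting bound on the integrand
    makes the integral bounded in \<open>z\<close>.\<close>
  define R where "R = \<bar>s\<bar> + \<bar>t\<bar>"
  obtain K M where K: "0 \<le> K" "\<And>r z. r \<in> {-R..R} \<Longrightarrow> norm (vel r z) \<le> K * norm z"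
    and M: "\<And>r z. r \<in> {-R..R} \<Longrightarrow> norm (B (pos r z)) \<le> M * norm z"
    using bounded_linear_T_bounded[OF bounded_linear_snd_Bj, of R]
      bounded_linear_T_bounded[OF bounded_linear_Bj_fst, of R]
    unfolding vel_def pos_def by metis
  have "norm (h z \<xi>) \<le> K * (M * norm z)" if "\<xi> \<in> {min 0 s..max 0 s}" for z \<xi>
  proof -
    have "s - \<xi> \<in> {-R..R}" "t - \<xi> \<in> {-R..R}"
      using that by (auto simp: R_def min_def max_def split: if_splits)
    then have "norm (h z \<xi>) \<le> K * norm (0::'y, B (pos (t - \<xi>) z))" "norm (B (pos (t - \<xi>) z)) \<le> M * norm z"
      using K M unfolding h_def by blast+
    then show ?thesis using K(1) mult_left_mono[of _ "M * norm z" K] by fastforce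
  qed
  then have "norm (oriented_integral 0 s (h z)) \<le> K * (M * norm z) * \<bar>s - 0\<bar>" for z
    by (intro oriented_integral_norm_le cont_h)
  then have "bounded_linear (\<lambda>z. oriented_integral 0 s (h z))"
    by (intro bounded_linear_intro[where K = "K * M * \<bar>s\<bar>"])
      (simp_all add: h_linear oriented_integral_add cont_h ac_simps
        oriented_integral_linear[OF cont_h bounded_linear_scaleR_right])
  then have "bounded_linear rhs"
    unfolding rhs_def
    by (intro bounded_linear_add bounded_linear_sub bounded_linear_Pair bounded_linear_zero
        bounded_linear_compose[OF bounded_linear_pos] bounded_linear_compose[OF bounded_linear_scaleR_right]
        bounded_linear_compose[OF bounded_linear_fst] bounded_linear_compose[OF bounded_linear_snd]
        bounded_linear_T bounded_linear_Bpos)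
  then have "closed {z. pos (t - s) z = rhs z}"
    using bounded_linear_pos by (intro closed_Collect_eq linear_continuous_on)
  moreover have "pos (t - s) z = rhs z" if "z \<in> D" for z
    unfolding rhs_def h_def oriented_integral_parts[OF that] pos_backward_D[OF that, of t s]
    by (simp add: algebra_simps)
  then have "D \<subseteq> {z. pos (t - s) z = rhs z}" by blast
  ultimately have "closure D \<subseteq> {z. pos (t - s) z = rhs z}"
    by (rule closure_minimal[rotated])
  then have "pos (t - s) z = rhs z" using dense_D by blast
  then show ?thesis by (simp add: rhs_def h_def[abs_def])
qed

section \<open>Sums and differences of forward and backward positions\<close>

lemma pos_forward: "pos (t + s) z = pos s (T t z)"
  by (simp add: pos_def add.commute[of t s] T_add)

lemma gen_cosine_pos:
  "gen_cosine j B T s (pos t z) = pos s (fst (T t z), B (pos t z))"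
  by (simp add: pos_def[of t] gen_cosine_eq)

text \<open>The forward and reversed data at time \<open>t\<close> share the position and have
  opposite velocities, so their difference is twice the sine data of the velocity.\<close>

lemma pos_minus:
  "pos (t + s) z - pos (t - s) z = 2 *\<^sub>R pos s (0, vel t z)
    - 4 *\<^sub>R oriented_integral 0 s (\<lambda>\<xi>. vel (s - \<xi>) (0, B (pos (t - \<xi>) z)))
    + 4 *\<^sub>R pos s (0, B (pos t z))"
proof -
  have "T t z - (fst (T t z), 2 *\<^sub>R B (pos t z) - snd (T t z)) = 2 *\<^sub>R (0, vel t z)"
    by (simp add: prod_eq_iff vel_def scaleR_2)
  then have "pos s (T t z) - pos s (fst (T t z), 2 *\<^sub>R B (pos t z) - snd (T t z)) = 2 *\<^sub>R pos s (0, vel t z)"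
    by (simp only: flip: pos_simps)
  then show ?thesis
    unfolding pos_forward pos_backward[of t s z] by (simp add: algebra_simps)
qed

text \<open>In the sum the velocities cancel, which leaves twice the cosine data of the
  position.\<close>

lemma pos_plus:
  "pos (t + s) z + pos (t - s) z = 2 *\<^sub>R gen_cosine j B T s (pos t z)
    + 4 *\<^sub>R oriented_integral 0 s (\<lambda>\<xi>. vel (s - \<xi>) (0, B (pos (t - \<xi>) z)))
    - 4 *\<^sub>R pos s (0, B (pos t z))"
proof -
  have "T t z + (fst (T t z), 2 *\<^sub>R B (pos t z) - snd (T t z)) = 2 *\<^sub>R (fst (T t z), B (pos t z))"
    by (simp add: prod_eq_iff scaleR_2)
  then have "pos s (T t z) + pos s (fst (T t z), 2 *\<^sub>R B (pos t z) - snd (T t z))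
      = 2 *\<^sub>R pos s (fst (T t z), B (pos t z))"
    by (simp only: flip: pos_simps)
  then show ?thesis
    unfolding pos_forward pos_backward[of t s z] gen_cosine_pos by (simp add: algebra_simps)
qed

lemma pos_minus_D:
  assumes "z \<in> D"
  shows "pos (t + s) z - pos (t - s) z = 2 *\<^sub>R pos s (0, vel t z)
    + 4 *\<^sub>R oriented_integral 0 s (\<lambda>\<xi>. pos (s - \<xi>) (0, B (vel (t - \<xi>) z)))"
  unfolding pos_minus oriented_integral_parts[OF assms] by (simp add: algebra_simps)

lemma pos_plus_D:
  assumes "z \<in> D"
  shows "pos (t + s) z + pos (t - s) z = 2 *\<^sub>R gen_cosine j B T s (pos t z)
    - 4 *\<^sub>R oriented_integral 0 s (\<lambda>\<xi>. pos (s - \<xi>) (0, B (vel (t - \<xi>) z)))"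
  unfolding pos_plus oriented_integral_parts[OF assms] by (simp add: algebra_simps)

end

theorem lemma5p8:
  fixes A B :: "'x \<Rightarrow> 'x::complex_banach"
    and DA DB :: "'x set"
    and j :: "'y::complex_banach \<Rightarrow> 'x"
    and T :: "real \<Rightarrow> 'y \<times> 'x \<Rightarrow> 'y \<times> 'x"
    and t s :: real
  defines "C \<equiv> gen_cosine j B T"
    and "S \<equiv> gen_sine j T"
  defines "C' \<equiv> strong_deriv C"
    and "S' \<equiv> strong_deriv S"
  assumes "closed_operator DA A"
    and "closed_operator DB B"
    and "resolvent_set DB B \<noteq> {}"
    and "continuous_embedding j"
    and "DA \<subseteq> {x \<in> DB. B x \<in> DB} \<inter> range j"
    and "B ` DA \<subseteq> range j"
    and "range j \<subseteq> DB"
    and "generates_C0_group (G_dom j DA) (G_op j A B) T"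
  shows
    "(\<forall>x\<in>DA. C (t + s) x - C (t - s) x =
        2 *\<^sub>R S s (C' t x) + 4 *\<^sub>R oriented_integral 0 s (\<lambda>\<xi>. S (s - \<xi>) (B (C' (t - \<xi>) x)))) \<and>
     (\<forall>y\<in>range j. C (t + s) y - C (t - s) y =
        2 *\<^sub>R S s (C' t y) - 4 *\<^sub>R oriented_integral 0 s (\<lambda>\<xi>. S' (s - \<xi>) (B (C (t - \<xi>) y)))
          + 4 *\<^sub>R S s (B (C t y))) \<and>
     (\<forall>x\<in>DA. C (t + s) x + C (t - s) x =
        2 *\<^sub>R C s (C t x) - 4 *\<^sub>R oriented_integral 0 s (\<lambda>\<xi>. S (s - \<xi>) (B (C' (t - \<xi>) x)))) \<and>
     (\<forall>y\<in>range j. C (t + s) y + C (t - s) y =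
        2 *\<^sub>R C s (C t y) + 4 *\<^sub>R oriented_integral 0 s (\<lambda>\<xi>. S' (s - \<xi>) (B (C (t - \<xi>) y)))
          - 4 *\<^sub>R S s (B (C t y))) \<and>
     (\<forall>y\<in>range j. S (t + s) y - S (t - s) y =
        2 *\<^sub>R S s (S' t y) + 4 *\<^sub>R oriented_integral 0 s (\<lambda>\<xi>. S (s - \<xi>) (B (S' (t - \<xi>) y)))) \<and>
     (\<forall>x. S (t + s) x - S (t - s) x =
        2 *\<^sub>R S s (S' t x) - 4 *\<^sub>R oriented_integral 0 s (\<lambda>\<xi>. S' (s - \<xi>) (B (S (t - \<xi>) x)))
          + 4 *\<^sub>R S s (B (S t x))) \<and>
     (\<forall>y\<in>range j. S (t + s) y + S (t - s) y =
        2 *\<^sub>R C s (S t y) - 4 *\<^sub>R oriented_integral 0 s (\<lambda>\<xi>. S (s - \<xi>) (B (S' (t - \<xi>) y)))) \<and>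
     (\<forall>x. S (t + s) x + S (t - s) x =
        2 *\<^sub>R C s (S t x) + 4 *\<^sub>R oriented_integral 0 s (\<lambda>\<xi>. S' (s - \<xi>) (B (S (t - \<xi>) x)))
          - 4 *\<^sub>R S s (B (S t x)))"
proof -
  interpret operator_matrix_group A B DA DB j T
    using assms(5,6,8-12) by unfold_locales
  \<comment> \<open>For \<open>x\<close> in \<open>DA\<close> the cosine data belong to the domain
    of the generator, as the formulas with \<open>B\<close> applied to \<open>C'\<close>
    require.\<close>
  have DA_range: "\<exists>y. x = j y \<and> (y, B (j y)) \<in> D" if "x \<in> DA" for x
  proof -
    from that DA obtain y where "x = j y" by blast
    with that cosine_data show ?thesis by blast
  qed
  have sine: "S = (\<lambda>t x. pos t (0, x))" "S' = (\<lambda>t x. vel t (0, x))"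
    unfolding S_def S'_def by (intro ext gen_sine_eq strong_deriv_sine)+
  have cosine: "C t (j y) = pos t (y, B (j y))" "C' t (j y) = vel t (y, B (j y))" for t y
    unfolding C_def C'_def by (rule gen_cosine_eq strong_deriv_cosine)+
  have i: "\<forall>x\<in>DA. C (t + s) x - C (t - s) x =
        2 *\<^sub>R S s (C' t x) + 4 *\<^sub>R oriented_integral 0 s (\<lambda>\<xi>. S (s - \<xi>) (B (C' (t - \<xi>) x)))"
    and iii: "\<forall>x\<in>DA. C (t + s) x + C (t - s) x =
        2 *\<^sub>R C s (C t x) - 4 *\<^sub>R oriented_integral 0 s (\<lambda>\<xi>. S (s - \<xi>) (B (C' (t - \<xi>) x)))"
    using pos_minus_D[of _ t s] pos_plus_D[of _ t s] DA_range
    by (fastforce simp: sine cosine C_def[symmetric])+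
  \<comment> \<open>(ii) and (iv) use the data \<open>(y, By)\<close>, (vi) and (viii) the data
    \<open>(0, x)\<close>; for (v) and (vii) the vector lies in \<open>range j\<close>, which puts
    the sine data into \<open>D\<close>.\<close>
  show ?thesis
    using i iii pos_minus[of t s] pos_plus[of t s] pos_minus_D[OF sine_data(1), of t s]
      pos_plus_D[OF sine_data(1), of t s]
    by (auto simp: sine cosine C_def[symmetric])
qed

end
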